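(* Let $F:\mathbb{R}^n\times\mathbb{R}^m\to\mathbb{R}$, $G:\mathbb{R}^n\times\mathbb{R}^m\to\mathbb{R}^p$, $\hat f:\mathbb{R}^n\times\mathbb{R}^m\to\mathbb{R}$ and $\hat g:\mathbb{R}^n\times\mathbb{R}^m\to\mathbb{R}^r$ be locally Lipschitz continuous, assume that $\operatorname{argmin}_y\{\hat f(x,y): \hat g(x,y)\le 0\}\ne\emptyset$ for every $x\in\mathbb{R}^n$, and assume that the lower-level value function $\varphi(x)=\min_y\{\hat f(x,y):\hat g(x,y)\le 0\}$ is locally Lipschitz continuous on $\mathbb{R}^n$. Consider the problem (LLVFR): $$\min_{x,y}F(x,y)\quad\text{s.t.}\quad G(x,y)\le 0,\ \hat g(x,y)\le 0,\ \hat f(x,y)-\varphi(x)\le 0.$$ If $(\bar x,\bar y)$ is feasible for (LLVFR) and LLVFR-subMFC holds at $(\bar x,\bar y)$, then $(\bar x,\bar y)$ is a KKT point of (LLVFR).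
   Context: Inequalities between vectors are componentwise; sums and multiples of sets are in the Minkowski sense, and an empty sum is $\{0\}$. $\partial\phi$ denotes the Clarke subdifferential of a locally Lipschitz function $\phi$ with respect to all its variables: $\partial\phi(\bar z)=\{s : s^\top d\le \phi^\circ(\bar z;d)\ \forall d\}$ with $\phi^\circ(\bar z;d)=\limsup_{z\to\bar z,\,h\downarrow 0}\frac{\phi(z+hd)-\phi(z)}{h}$. The function $\hat f-\varphi$ is $(x,y)\mapsto\hat f(x,y)-\varphi(x)$. KKT point of (LLVFR): a point $(\bar x,\bar y)$ for which there are $u\in\mathbb{R}^p$, $v\in\mathbb{R}^r$, $w\in\mathbb{R}$, all $\ge 0$, with $0\in\partial F(\bar x,\bar y)+\sum_{i=1}^pu_i\partial G_i(\bar x,\bar y)+\sum_{j=1}^rv_j\partial\hat g_j(\bar x,\bar y)+w\,\partial(\hat f-\varphi)(\bar x,\bar y)$, $(\bar x,\bar y)$ feasible for (LLVFR), $u^\top G(\bar x,\bar y)=0$, $v^\top\hat g(\bar x,\bar y)=0$ and $w(\hat f(\bar x,\bar y)-\varphi(\bar x))=0$. Active sets at a feasible point: $I^G(\bar x,\bar y)=\{i: G_i(\bar x,\bar y)=0\}$, $I^{\hat g}(\bar x,\bar y)=\{j:\hat g_j(\bar x,\bar y)=0\}$, $I^{\hat f-\varphi}(\bar x,\bar y)=\{1\}$ (the value function constraint is always active at feasible points). LLVFR-subMFC holds at a feasible $(\bar x,\bar y)$ if there exist $I_1\subseteq I^G(\bar x,\bar y)$, $I_2\subseteq I^{\hat g}(\bar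 x,\bar y)$ and $I_3\subseteq\{1\}$ such that: (i) Either $I_1=I_2=I_3=\emptyset$, or for all nonnegative multipliers $u=(u_i)_{i\in I_1}$, $v=(v_j)_{j\in I_2}$ and $w$ (with $w$ present only if $I_3=\{1\}$), not all zero, one has $0\notin\sum_{i\in I_1}u_i\partial G_i(\bar x,\bar y)+\sum_{j\in I_2}v_j\partial\hat g_j(\bar x,\bar y)+R$, where $R=w\,\partial(\hat f-\varphi)(\bar x,\bar y)$ if $I_3=\{1\}$ and $R=\{0\}$ if $I_3=\emptyset$. (ii) There exists a sequence $\{(x^k,y^k,u^k,v^k,w^k,\delta^k,\hat\delta^k,\gamma_k,\epsilon^k)\}_{k=1}^\infty$ (with $u^k,\delta^k\in\mathbb{R}^p$, $v^k,\hat\delta^k\in\mathbb{R}^r$, $w^k,\gamma_k\in\mathbb{R}$, $\epsilon^k\in\mathbb{R}^{n+m}$) such that for all $k\in\mathbb{N}$: $\epsilon^k\in\partial F(x^k,y^k)+\sum_{i=1}^pu^k_i\partial G_i(x^k,y^k)+\sum_{j=1}^rv^k_j\partial\hat g_j(x^k,y^k)+w^k\partial(\hat f-\varphi)(x^k,y^k)$; $u^k\ge 0$, $G(x^k,y^k)\le\delta^k$, $(u^k)^\top(G(x^k,y^k)-\delta^k)=0$; $v^k\ge 0$, $\hat g(x^k,y^k)\le\hat\delta^k$, $(v^k)^\top(\hat g(x^k,y^k)-\hat\delta^k)=0$; $w^k\ge 0$, $\hat f(x^k,y^k)-\varphi(x^k)\le\gamma_k$, $w^k(\hat f(x^k,y^k)-\varphi(x^k)-\gamma_k)=0$;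 moreover $(x^k,y^k,\delta^k,\hat\delta^k,\gamma_k,\epsilon^k)\to(\bar x,\bar y,0,0,0,0)$ as $k\to\infty$; and for all $k\in\mathbb{N}$, $I_1=\{i: G_i(x^k,y^k)=\delta^k_i\}$, $I_2=\{j:\hat g_j(x^k,y^k)=\hat\delta^k_j\}$, and $I_3=\{1\}$ if $\hat f(x^k,y^k)-\varphi(x^k)=\gamma_k$, $I_3=\emptyset$ if $\hat f(x^k,y^k)-\varphi(x^k)<\gamma_k$. *)

theory Defs
  imports "HOL-Analysis.Analysis" "HOL-Library.Set_Algebras"
begin

text \<open>
  Vectors of \<open>\<real>\<^sup>p\<close> and \<open>\<real>\<^sup>r\<close> (constraint values, multipliers, perturbations) are families indexed by
  \<open>{1..p}\<close> and \<open>{1..r}\<close>; values outside these ranges are never used, and \<open>p = 0\<close> or \<open>r = 0\<close> is allowed.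
  A point of \<open>\<real>\<^sup>n \<times> \<real>\<^sup>m\<close> is a pair, so \<open>G i (x, y)\<close> is the \<open>i\<close>-th component of \<open>G(x, y)\<close>.
  Sums of sets are Minkowski sums (\<^theory>\<open>HOL-Library.Set_Algebras\<close>), with the empty sum \<open>{0}\<close>.
\<close>

definition locally_lipschitz :: "('a::metric_space \<Rightarrow> 'b::metric_space) \<Rightarrow> bool" where
  "locally_lipschitz \<phi> \<longleftrightarrow> (\<forall>z. \<exists>e>0. \<exists>L. L-lipschitz_on (cball z e) \<phi>)"

text \<open>The base point tends to \<open>z\<close> along \<open>nhds z\<close>, i.e. it may equal \<open>z\<close>.
  The upper limit is taken in \<^typ>\<open>ereal\<close>, where it always exists.\<close>

definition clarke_dir_deriv :: "('a::real_inner \<Rightarrow> real) \<Rightarrow> 'a \<Rightarrow> 'a \<Rightarrow> ereal" where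
  "clarke_dir_deriv \<phi> z d =
     Limsup (nhds z \<times>\<^sub>F at_right 0) (\<lambda>(z', h). ereal ((\<phi> (z' + h *\<^sub>R d) - \<phi> z') / h))"

definition clarke_subdiff :: "('a::real_inner \<Rightarrow> real) \<Rightarrow> 'a \<Rightarrow> 'a set" where
  "clarke_subdiff \<phi> z = {s. \<forall>d. ereal (s \<bullet> d) \<le> clarke_dir_deriv \<phi> z d}"

abbreviation set_scale :: "real \<Rightarrow> 'a::real_vector set \<Rightarrow> 'a set" (infixr \<open>*\<^sub>S\<close> 75) where
  "c *\<^sub>S S \<equiv> (\<lambda>s. c *\<^sub>R s) ` S"

definition lower_feasible :: "nat \<Rightarrow> (nat \<Rightarrow> 'a \<times> 'b \<Rightarrow> real) \<Rightarrow> 'a \<Rightarrow> 'b \<Rightarrow> bool" where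
  "lower_feasible r g x y \<longleftrightarrow> (\<forall>j\<in>{1..r}. g j (x, y) \<le> 0)"

text \<open>\<open>LEAST\<close> is the minimum of the set of attained values; it is meaningful when the minimum
  exists, which the nonemptiness of the argmin guarantees.\<close>

definition value_function ::
  "nat \<Rightarrow> ('a \<times> 'b \<Rightarrow> real) \<Rightarrow> (nat \<Rightarrow> 'a \<times> 'b \<Rightarrow> real) \<Rightarrow> 'a \<Rightarrow> real" where
  "value_function r f g x = (LEAST t. \<exists>y. lower_feasible r g x y \<and> t = f (x, y))"

definition value_gap ::
  "nat \<Rightarrow> ('a \<times> 'b \<Rightarrow> real) \<Rightarrow> (nat \<Rightarrow> 'a \<times> 'b \<Rightarrow> real) \<Rightarrow> 'a \<times> 'b \<Rightarrow> real" where
  "value_gap r f g = (\<lambda>(x, y). f (x, y) - value_function r f g x)"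

definition llvfr_feasible ::
  "nat \<Rightarrow> nat \<Rightarrow> (nat \<Rightarrow> 'a \<times> 'b \<Rightarrow> real) \<Rightarrow> ('a \<times> 'b \<Rightarrow> real) \<Rightarrow> (nat \<Rightarrow> 'a \<times> 'b \<Rightarrow> real)
    \<Rightarrow> 'a \<times> 'b \<Rightarrow> bool" where
  "llvfr_feasible p r G f g z \<longleftrightarrow>
     (\<forall>i\<in>{1..p}. G i z \<le> 0) \<and> (\<forall>j\<in>{1..r}. g j z \<le> 0) \<and> value_gap r f g z \<le> 0"

definition llvfr_KKT ::
  "nat \<Rightarrow> nat \<Rightarrow> ('a::real_inner \<times> 'b::real_inner \<Rightarrow> real) \<Rightarrow> (nat \<Rightarrow> 'a \<times> 'b \<Rightarrow> real)
    \<Rightarrow> ('a \<times> 'b \<Rightarrow> real) \<Rightarrow> (nat \<Rightarrow> 'a \<times> 'b \<Rightarrow> real) \<Rightarrow> 'a \<times> 'b \<Rightarrow> bool" where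
  "llvfr_KKT p r F G f g z \<longleftrightarrow>
     (\<exists>(u :: nat \<Rightarrow> real) (v :: nat \<Rightarrow> real) (w :: real).
        (\<forall>i\<in>{1..p}. 0 \<le> u i) \<and> (\<forall>j\<in>{1..r}. 0 \<le> v j) \<and> 0 \<le> w \<and>
        0 \<in> clarke_subdiff F z
            + (\<Sum>i\<in>{1..p}. u i *\<^sub>S clarke_subdiff (G i) z)
            + (\<Sum>j\<in>{1..r}. v j *\<^sub>S clarke_subdiff (g j) z)
            + w *\<^sub>S clarke_subdiff (value_gap r f g) z \<and>
        llvfr_feasible p r G f g z \<and>
        (\<Sum>i\<in>{1..p}. u i * G i z) = 0 \<and>
        (\<Sum>j\<in>{1..r}. v j * g j z) = 0 \<and>
        w * value_gap r f g z = 0)"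

definition llvfr_subMFC_independent ::
  "nat \<Rightarrow> (nat \<Rightarrow> 'a::real_inner \<times> 'b::real_inner \<Rightarrow> real)
    \<Rightarrow> ('a \<times> 'b \<Rightarrow> real) \<Rightarrow> (nat \<Rightarrow> 'a \<times> 'b \<Rightarrow> real) \<Rightarrow> 'a \<times> 'b
    \<Rightarrow> nat set \<Rightarrow> nat set \<Rightarrow> nat set \<Rightarrow> bool" where
  "llvfr_subMFC_independent r G f g z I1 I2 I3 \<longleftrightarrow>
     (I1 = {} \<and> I2 = {} \<and> I3 = {}) \<or>
     (\<forall>(u :: nat \<Rightarrow> real) (v :: nat \<Rightarrow> real) (w :: real).
        (\<forall>i\<in>I1. 0 \<le> u i) \<and> (\<forall>j\<in>I2. 0 \<le> v j) \<and> (I3 = {1} \<longrightarrow> 0 \<le> w) \<and>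
        ((\<exists>i\<in>I1. u i \<noteq> 0) \<or> (\<exists>j\<in>I2. v j \<noteq> 0) \<or> (I3 = {1} \<and> w \<noteq> 0)) \<longrightarrow>
        0 \<notin> (\<Sum>i\<in>I1. u i *\<^sub>S clarke_subdiff (G i) z)
            + (\<Sum>j\<in>I2. v j *\<^sub>S clarke_subdiff (g j) z)
            + (if I3 = {1} then w *\<^sub>S clarke_subdiff (value_gap r f g) z else {0}))"

definition llvfr_subMFC_sequence ::
  "nat \<Rightarrow> nat \<Rightarrow> ('a::real_inner \<times> 'b::real_inner \<Rightarrow> real) \<Rightarrow> (nat \<Rightarrow> 'a \<times> 'b \<Rightarrow> real)
    \<Rightarrow> ('a \<times> 'b \<Rightarrow> real) \<Rightarrow> (nat \<Rightarrow> 'a \<times> 'b \<Rightarrow> real) \<Rightarrow> 'a \<times> 'b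
    \<Rightarrow> nat set \<Rightarrow> nat set \<Rightarrow> nat set \<Rightarrow> bool" where
  "llvfr_subMFC_sequence p r F G f g z I1 I2 I3 \<longleftrightarrow>
     (\<exists>(zs :: nat \<Rightarrow> 'a \<times> 'b) (u :: nat \<Rightarrow> nat \<Rightarrow> real) (v :: nat \<Rightarrow> nat \<Rightarrow> real) (w :: nat \<Rightarrow> real)
        (\<delta> :: nat \<Rightarrow> nat \<Rightarrow> real) (\<delta>' :: nat \<Rightarrow> nat \<Rightarrow> real) (\<gamma> :: nat \<Rightarrow> real) (\<epsilon> :: nat \<Rightarrow> 'a \<times> 'b).
        (\<forall>k. \<epsilon> k \<in> clarke_subdiff F (zs k)
                  + (\<Sum>i\<in>{1..p}. u k i *\<^sub>S clarke_subdiff (G i) (zs k))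
                  + (\<Sum>j\<in>{1..r}. v k j *\<^sub>S clarke_subdiff (g j) (zs k))
                  + w k *\<^sub>S clarke_subdiff (value_gap r f g) (zs k) \<and>
             (\<forall>i\<in>{1..p}. 0 \<le> u k i) \<and> (\<forall>i\<in>{1..p}. G i (zs k) \<le> \<delta> k i) \<and>
             (\<Sum>i\<in>{1..p}. u k i * (G i (zs k) - \<delta> k i)) = 0 \<and>
             (\<forall>j\<in>{1..r}. 0 \<le> v k j) \<and> (\<forall>j\<in>{1..r}. g j (zs k) \<le> \<delta>' k j) \<and>
             (\<Sum>j\<in>{1..r}. v k j * (g j (zs k) - \<delta>' k j)) = 0 \<and>
             0 \<le> w k \<and> value_gap r f g (zs k) \<le> \<gamma> k \<and>
             w k * (value_gap r f g (zs k) - \<gamma> k) = 0) \<and>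
        zs \<longlonglongrightarrow> z \<and>
        (\<forall>i\<in>{1..p}. (\<lambda>k. \<delta> k i) \<longlonglongrightarrow> 0) \<and>
        (\<forall>j\<in>{1..r}. (\<lambda>k. \<delta>' k j) \<longlonglongrightarrow> 0) \<and>
        \<gamma> \<longlonglongrightarrow> 0 \<and> \<epsilon> \<longlonglongrightarrow> 0 \<and>
        (\<forall>k. I1 = {i \<in> {1..p}. G i (zs k) = \<delta> k i} \<and>
             I2 = {j \<in> {1..r}. g j (zs k) = \<delta>' k j} \<and>
             (value_gap r f g (zs k) = \<gamma> k \<longrightarrow> I3 = {1}) \<and>
             (value_gap r f g (zs k) < \<gamma> k \<longrightarrow> I3 = {})))"

text \<open>The value function constraint is always active at feasible points, so its active set is \<open>{1}\<close>.\<close>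

definition llvfr_subMFC ::
  "nat \<Rightarrow> nat \<Rightarrow> ('a::real_inner \<times> 'b::real_inner \<Rightarrow> real) \<Rightarrow> (nat \<Rightarrow> 'a \<times> 'b \<Rightarrow> real)
    \<Rightarrow> ('a \<times> 'b \<Rightarrow> real) \<Rightarrow> (nat \<Rightarrow> 'a \<times> 'b \<Rightarrow> real) \<Rightarrow> 'a \<times> 'b \<Rightarrow> bool" where
  "llvfr_subMFC p r F G f g z \<longleftrightarrow>
     (\<exists>I1 I2 I3.
        I1 \<subseteq> {i \<in> {1..p}. G i z = 0} \<and> I2 \<subseteq> {j \<in> {1..r}. g j z = 0} \<and> I3 \<subseteq> {1} \<and>
        llvfr_subMFC_independent r G f g z I1 I2 I3 \<and>
        llvfr_subMFC_sequence p r F G f g z I1 I2 I3)"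

end

theory Submission
  imports Defs
begin

text \<open>
  Complementarity forces the multipliers in the subMFC sequence to vanish outside \<open>I1\<close>, \<open>I2\<close>, \<open>I3\<close>.
  Dividing the approximate stationarity condition by one plus the sum of all multipliers makes every
  coefficient bounded; subgradients along a convergent sequence are bounded as well, so a subsequence
  of everything converges, and closedness of the Clarke subdifferential yields a Fritz John condition
  at the limit. If the coefficient of the objective vanished there, it would contradict part (i) of subMFC;
  otherwise dividing by it gives the KKT condition.
\<close>

section \<open>Clarke subgradients: local boundedness and closed graph\<close>

text \<open>Test the subgradient inequality in the direction \<open>s\<close> itself. Since
  \<open>z'\<close> lies in the open ball, both endpoints of each difference quotient eventually
  stay there, so \<open>s \<bullet> s\<close> is at most \<open>L * norm s\<close>.\<close>

lemma clarke_subdiff_norm_le: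
  fixes \<phi> :: "'a::real_inner \<Rightarrow> real"
  assumes L: "L-lipschitz_on (cball z e) \<phi>" and z': "z' \<in> ball z e" and s: "s \<in> clarke_subdiff \<phi> z'"
  shows "norm s \<le> L"
proof -
  let ?F = "nhds z' \<times>\<^sub>F at_right (0::real)"
  have fst: "(fst \<longlongrightarrow> z') ?F" by (rule filterlim_fst)
  have snd: "filterlim snd (at_right 0) ?F" by (rule filterlim_snd)
  have snd0: "(snd \<longlongrightarrow> 0) ?F"
    using snd by (rule filterlim_mono) (auto simp: at_within_le_nhds)
  have "((\<lambda>p. fst p + snd p *\<^sub>R s) \<longlongrightarrow> z' + 0 *\<^sub>R s) ?F"
    by (intro tendsto_intros fst snd0)
  then have "\<forall>\<^sub>F p in ?F. fst p + snd p *\<^sub>R s \<in> ball z e"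
    using z' by (auto dest: topological_tendstoD)
  moreover have "\<forall>\<^sub>F p in ?F. fst p \<in> ball z e"
    using fst z' by (auto dest: topological_tendstoD)
  moreover have "\<forall>\<^sub>F p in ?F. snd p > 0"
    using filterlim_iff[THEN iffD1, OF snd] eventually_at_right_less by blast
  ultimately have "\<forall>\<^sub>F p in ?F.
      (case p of (w, h) \<Rightarrow> ereal ((\<phi> (w + h *\<^sub>R s) - \<phi> w) / h)) \<le> ereal (L * norm s)"
  proof eventually_elim
    case (elim p)
    obtain w h where p: "p = (w, h)" by force
    have "dist (\<phi> (w + h *\<^sub>R s)) (\<phi> w) \<le> L * dist (w + h *\<^sub>R s) w"
      by (rule lipschitz_onD[OF L]) (use elim p in auto)
    then have "\<phi> (w + h *\<^sub>R s) - \<phi> w \<le> (L * norm s) * h"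
      using elim p by (simp add: dist_norm mult_ac)
    then show ?case using elim p by (simp add: divide_le_eq)
  qed
  then have "clarke_dir_deriv \<phi> z' s \<le> ereal (L * norm s)"
    unfolding clarke_dir_deriv_def by (rule Limsup_bounded)
  moreover have "ereal (s \<bullet> s) \<le> clarke_dir_deriv \<phi> z' s"
    using s by (auto simp: clarke_subdiff_def)
  ultimately have "ereal (s \<bullet> s) \<le> ereal (L * norm s)" by (rule order_trans[rotated])
  then have "norm s * norm s \<le> L * norm s"
    by (simp add: dot_square_norm power2_eq_square)
  then show ?thesis
    using lipschitz_on_nonneg[OF L] by (cases "s = 0") auto
qed

lemma clarke_subdiff_bounded_seq:
  fixes \<phi> :: "'a::real_inner \<Rightarrow> real"
  assumes "locally_lipschitz \<phi>" and zs: "zs \<longlonglongrightarrow> z" and s: "\<And>k. s k \<in> clarke_subdiff \<phi> (zs k)"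
  shows "bounded (range s)"
proof -
  obtain e L where e: "e > 0" and L: "L-lipschitz_on (cball z e) \<phi>"
    using assms(1) unfolding locally_lipschitz_def by blast
  have "\<forall>\<^sub>F k in sequentially. zs k \<in> ball z e"
    using topological_tendstoD[OF zs open_ball] e by simp
  then have "\<forall>\<^sub>F k in sequentially. norm (s k) \<le> L"
    by eventually_elim (rule clarke_subdiff_norm_le[OF L _ s])
  \<comment> \<open>\<open>Bseq\<close> only asks for a bound on a tail, which is what the local
    Lipschitz ball provides; the finitely many earlier terms cannot destroy boundedness of the
    range.\<close>
  then have "Bseq s" by (rule BfunI)
  then show ?thesis by (simp add: Bseq_eq_bounded)
qed

text \<open>The Clarke directional derivative is upper semicontinuous in the base point: a bound on
  all quotients based near \<open>z\<close> also bounds those based near \<open>zs k\<close>, once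
  \<open>zs k\<close> is close enough to \<open>z\<close>.\<close>

lemma clarke_subdiff_closed:
  fixes \<phi> :: "'a::real_inner \<Rightarrow> real"
  assumes zs: "zs \<longlonglongrightarrow> z" and s: "s \<longlonglongrightarrow> l" and mem: "\<And>k. s k \<in> clarke_subdiff \<phi> (zs k)"
  shows "l \<in> clarke_subdiff \<phi> z"
  unfolding clarke_subdiff_def
proof (intro CollectI allI)
  fix d
  let ?q = "\<lambda>(w, h). ereal ((\<phi> (w + h *\<^sub>R d) - \<phi> w) / h)"
  show "ereal (l \<bullet> d) \<le> clarke_dir_deriv \<phi> z d"
  \<comment> \<open>Working with an arbitrary \<open>c\<close> strictly above the derivative turns
    the upper limit into an eventual bound on the quotients, and covers infinite values as
    well.\<close>
  proof (rule dense_ge)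
    fix c assume "clarke_dir_deriv \<phi> z d < c"
    then have "\<forall>\<^sub>F p in nhds z \<times>\<^sub>F at_right 0. ?q p < c"
      unfolding clarke_dir_deriv_def by (rule Limsup_lessD)
    then obtain P Q where P: "eventually P (nhds z)" and Q: "eventually Q (at_right (0::real))"
      and PQ: "\<And>w h. P w \<Longrightarrow> Q h \<Longrightarrow> ?q (w, h) < c"
      unfolding eventually_prod_filter by blast
    \<comment> \<open>A neighbourhood of \<open>z\<close> is also a neighbourhood of every point
      near \<open>z\<close>. The condition \<open>Q\<close> on the step size does not involve the
      base point and is reused unchanged.\<close>
    have "\<forall>\<^sub>F w in nhds z. eventually P (nhds w)"
      using P by (simp add: eventually_eventually)
    then have "\<forall>\<^sub>F k in sequentially. eventually P (nhds (zs k))"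
      using zs by (auto simp: filterlim_iff)
    then have "\<forall>\<^sub>F k in sequentially. ereal (s k \<bullet> d) \<le> c"
    proof eventually_elim
      case (elim k)
      have "\<forall>\<^sub>F p in nhds (zs k) \<times>\<^sub>F at_right 0. ?q p \<le> c"
        unfolding eventually_prod_filter using elim Q PQ less_imp_le by blast
      then have "clarke_dir_deriv \<phi> (zs k) d \<le> c"
        unfolding clarke_dir_deriv_def by (rule Limsup_bounded)
      moreover have "ereal (s k \<bullet> d) \<le> clarke_dir_deriv \<phi> (zs k) d"
        using mem by (auto simp: clarke_subdiff_def)
      ultimately show ?case by (rule order_trans[rotated])
    qed
    moreover have "(\<lambda>k. ereal (s k \<bullet> d)) \<longlonglongrightarrow> ereal (l \<bullet> d)"
      by (intro tendsto_intros s)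
    ultimately show "ereal (l \<bullet> d) \<le> c"
      by (intro tendsto_upperbound[where F = sequentially]) auto
  qed
qed

section \<open>Compactness and passage to the limit in approximate stationarity\<close>

text \<open>Subsequences are extracted one index at a time; limits obtained earlier survive each
  further extraction.\<close>

lemma finite_bounded_imp_common_convergent_subsequence:
  fixes x :: "'i \<Rightarrow> nat \<Rightarrow> 'a::heine_borel"
  assumes "finite A" and "\<And>a. a \<in> A \<Longrightarrow> bounded (range (x a))"
  shows "\<exists>\<sigma> :: nat \<Rightarrow> nat. strict_mono \<sigma> \<and> (\<forall>a\<in>A. convergent (x a \<circ> \<sigma>))"
  using assms
proof (induction A rule: finite_induct)
  case empty
  show ?case using strict_mono_id by auto
next
  case (insert b A)
  then obtain \<sigma> :: "nat \<Rightarrow> nat" where \<sigma>: "strict_mono \<sigma>" "\<forall>a\<in>A. convergent (x a \<circ> \<sigma>)" by blast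
  have "bounded (range (x b \<circ> \<sigma>))"
    by (rule bounded_subset[of "range (x b)"]) (use insert.prems in auto)
  then obtain l \<tau> where \<tau>: "strict_mono \<tau>" "((x b \<circ> \<sigma>) \<circ> \<tau>) \<longlonglongrightarrow> l"
    using bounded_imp_convergent_subsequence by blast
  have "convergent (x a \<circ> (\<sigma> \<circ> \<tau>))" if "a \<in> insert b A" for a
    using that \<sigma>(2) \<tau> by (auto simp: convergent_def o_assoc intro: LIMSEQ_subseq_LIMSEQ)
  with \<sigma>(1) \<tau>(1) show ?case by (blast intro: strict_mono_o)
qed

text \<open>The multipliers \<open>\<mu>\<close> may be unbounded, so only their normalised versions
  are taken to the limit; \<open>\<rho>\<close> is the limiting coefficient of \<open>F\<close> and
  may be zero. Total weight 1 keeps the limit nontrivial, and the last conclusion keeps constraints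
  that are inactive along the sequence out of the limit condition.\<close>

lemma fritz_john_limit:
  fixes F :: "'a::euclidean_space \<Rightarrow> real" and \<phi> :: "'i \<Rightarrow> 'a \<Rightarrow> real"
  assumes A: "finite A" and F: "locally_lipschitz F"
    and \<phi>: "\<And>a. a \<in> A \<Longrightarrow> locally_lipschitz (\<phi> a)"
    and zs: "zs \<longlonglongrightarrow> z" and \<epsilon>: "\<epsilon> \<longlonglongrightarrow> 0"
    and s0: "\<And>k. s0 k \<in> clarke_subdiff F (zs k)"
    and s: "\<And>k a. a \<in> A \<Longrightarrow> s k a \<in> clarke_subdiff (\<phi> a) (zs k)"
    and \<mu>: "\<And>k a. a \<in> A \<Longrightarrow> 0 \<le> \<mu> k a"
    and eq: "\<And>k. \<epsilon> k = s0 k + (\<Sum>a\<in>A. \<mu> k a *\<^sub>R s k a)"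
  obtains \<rho> \<nu> t0 t where "0 \<le> \<rho>" "\<And>a. a \<in> A \<Longrightarrow> 0 \<le> \<nu> a" "\<rho> + (\<Sum>a\<in>A. \<nu> a) = 1"
    "t0 \<in> clarke_subdiff F z" "\<And>a. a \<in> A \<Longrightarrow> t a \<in> clarke_subdiff (\<phi> a) z"
    "\<rho> *\<^sub>R t0 + (\<Sum>a\<in>A. \<nu> a *\<^sub>R t a) = 0"
    "\<And>a. a \<in> A \<Longrightarrow> (\<And>k. \<mu> k a = 0) \<Longrightarrow> \<nu> a = 0"
proof -
  \<comment> \<open>The summand 1 is the coefficient of \<open>F\<close>. It ensures
    \<open>N k \<ge> 1\<close>, so division is safe and all normalised coefficients lie between 0
    and 1.\<close>
  define N where "N k = 1 + (\<Sum>a\<in>A. \<mu> k a)" for k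
  have N: "N k \<ge> 1" for k using \<mu> by (simp add: N_def sum_nonneg)
  have N0: "N k > 0" for k using N[of k] by linarith
  have \<mu>N: "\<mu> k a \<le> N k" if "a \<in> A" for a k
    using member_le_sum[of a A "\<mu> k"] A \<mu> that by (auto simp: N_def)
  \<comment> \<open>Each subgradient is paired with its normalised coefficient, so that one
    extraction makes both converge.\<close>
  define x where "x = (\<lambda>a k. (s k a, \<mu> k a / N k))"
  define y where "y = (\<lambda>k. (s0 k, 1 / N k))"
  have unit: "bounded (range f)" if "\<And>k. 0 \<le> f k \<and> f k \<le> (1::real)" for f :: "nat \<Rightarrow> real"
    by (rule bounded_subset[OF bounded_closed_interval[of 0 1]]) (use that in auto)
  have y_bdd: "bounded (range y)"
    by (rule bounded_subset[OF bounded_Times[OF clarke_subdiff_bounded_seq[OF F zs s0] unit[of "\<lambda>k. 1 / N k"]]])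
      (use N N0 in \<open>auto simp: y_def less_imp_le\<close>)
  have x_bdd: "bounded (range (x a))" if "a \<in> A" for a
    by (rule bounded_subset[OF bounded_Times[OF clarke_subdiff_bounded_seq[OF \<phi>[OF that] zs s[OF that]]
            unit[of "\<lambda>k. \<mu> k a / N k"]]])
      (use \<mu>N[OF that] N0 \<mu>[OF that] in \<open>auto simp: x_def less_imp_le\<close>)
  \<comment> \<open>The index \<open>None\<close> stands for the objective and \<open>Some a\<close>
    for the constraint \<open>a\<close>, so a single family contains all pairs and one
    \<open>\<sigma>\<close> serves them all.\<close>
  obtain \<sigma> :: "nat \<Rightarrow> nat" where \<sigma>: "strict_mono \<sigma>"
    and conv: "\<And>b. b \<in> insert None (Some ` A) \<Longrightarrow> convergent (case_option y x b \<circ> \<sigma>)"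
  proof -
    have "bounded (range (case_option y x b))" if "b \<in> insert None (Some ` A)" for b
      using that x_bdd y_bdd by auto
    with A have "\<exists>\<sigma> :: nat \<Rightarrow> nat. strict_mono \<sigma> \<and>
        (\<forall>b\<in>insert None (Some ` A). convergent (case_option y x b \<circ> \<sigma>))"
      by (intro finite_bounded_imp_common_convergent_subsequence) auto
    then show ?thesis using that by blast
  qed
  obtain ly where ly: "(y \<circ> \<sigma>) \<longlonglongrightarrow> ly" using conv[of None] by (auto simp: convergent_def)
  have "\<exists>l. (x a \<circ> \<sigma>) \<longlonglongrightarrow> l" if "a \<in> A" for a
    using conv[of "Some a"] that by (simp add: convergent_def)
  then obtain lx where lx: "\<And>a. a \<in> A \<Longrightarrow> (x a \<circ> \<sigma>) \<longlonglongrightarrow> lx a" by metis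
  have lim_s0: "(\<lambda>k. s0 (\<sigma> k)) \<longlonglongrightarrow> fst ly" and lim_\<rho>: "(\<lambda>k. 1 / N (\<sigma> k)) \<longlonglongrightarrow> snd ly"
    using tendsto_fst[OF ly] tendsto_snd[OF ly] by (auto simp: y_def o_def)
  have lim_s: "(\<lambda>k. s (\<sigma> k) a) \<longlonglongrightarrow> fst (lx a)"
    and lim_\<nu>: "(\<lambda>k. \<mu> (\<sigma> k) a / N (\<sigma> k)) \<longlonglongrightarrow> snd (lx a)" if "a \<in> A" for a
    using tendsto_fst[OF lx[OF that]] tendsto_snd[OF lx[OF that]] by (auto simp: x_def o_def)
  have zs\<sigma>: "(\<lambda>k. zs (\<sigma> k)) \<longlonglongrightarrow> z" and \<epsilon>\<sigma>: "(\<lambda>k. \<epsilon> (\<sigma> k)) \<longlonglongrightarrow> 0"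
    using LIMSEQ_subseq_LIMSEQ[OF zs \<sigma>] LIMSEQ_subseq_LIMSEQ[OF \<epsilon> \<sigma>] by (auto simp: o_def)
  show thesis
  proof (rule that[of "snd ly" "\<lambda>a. snd (lx a)" "fst ly" "\<lambda>a. fst (lx a)"])
    show "0 \<le> snd ly"
      by (rule LIMSEQ_le_const[OF lim_\<rho>]) (use N0 less_imp_le in auto)
    show "0 \<le> snd (lx a)" if "a \<in> A" for a
      by (rule LIMSEQ_le_const[OF lim_\<nu>[OF that]])
        (use N0 \<mu>[OF that] in \<open>auto intro!: divide_nonneg_pos\<close>)
    have "(\<lambda>k. 1 / N (\<sigma> k) + (\<Sum>a\<in>A. \<mu> (\<sigma> k) a / N (\<sigma> k))) \<longlonglongrightarrow> snd ly + (\<Sum>a\<in>A. snd (lx a))"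
      by (intro tendsto_intros lim_\<rho> lim_\<nu>)
    moreover have "1 / N k + (\<Sum>a\<in>A. \<mu> k a / N k) = 1" for k
    proof -
      have "1 / N k + (\<Sum>a\<in>A. \<mu> k a / N k) = (1 + (\<Sum>a\<in>A. \<mu> k a)) / N k"
        by (simp only: sum_divide_distrib add_divide_distrib)
      then show ?thesis using N0[of k] by (simp add: N_def)
    qed
    ultimately show "snd ly + (\<Sum>a\<in>A. snd (lx a)) = 1" by (simp add: LIMSEQ_const_iff)
    show "fst ly \<in> clarke_subdiff F z"
      by (rule clarke_subdiff_closed[OF zs\<sigma> lim_s0]) (rule s0)
    show "fst (lx a) \<in> clarke_subdiff (\<phi> a) z" if "a \<in> A" for a
      by (rule clarke_subdiff_closed[OF zs\<sigma> lim_s[OF that]]) (rule s[OF that])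
    \<comment> \<open>The same sequence is \<open>\<epsilon>\<close> divided by \<open>N\<close>,
      which tends to 0 because \<open>1 / N\<close> converges along \<open>\<sigma>\<close>;
      uniqueness of limits gives the stationarity equation.\<close>
    have "(\<lambda>k. (1 / N (\<sigma> k)) *\<^sub>R s0 (\<sigma> k) + (\<Sum>a\<in>A. (\<mu> (\<sigma> k) a / N (\<sigma> k)) *\<^sub>R s (\<sigma> k) a))
        \<longlonglongrightarrow> snd ly *\<^sub>R fst ly + (\<Sum>a\<in>A. snd (lx a) *\<^sub>R fst (lx a))"
      by (intro tendsto_intros lim_\<rho> lim_\<nu> lim_s0 lim_s)
    moreover have "(1 / N k) *\<^sub>R s0 k + (\<Sum>a\<in>A. (\<mu> k a / N k) *\<^sub>R s k a) = (1 / N k) *\<^sub>R \<epsilon> k" for k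
      by (simp add: eq scaleR_add_right scaleR_sum_right)
    moreover have "(\<lambda>k. (1 / N (\<sigma> k)) *\<^sub>R \<epsilon> (\<sigma> k)) \<longlonglongrightarrow> snd ly *\<^sub>R 0"
      by (intro tendsto_intros lim_\<rho> \<epsilon>\<sigma>)
    ultimately show "snd ly *\<^sub>R fst ly + (\<Sum>a\<in>A. snd (lx a) *\<^sub>R fst (lx a)) = 0"
      by (simp add: LIMSEQ_unique)
    show "snd (lx a) = 0" if "a \<in> A" "\<And>k. \<mu> k a = 0" for a
      using lim_\<nu>[OF that(1)] that(2) by (simp add: LIMSEQ_const_iff)
  qed
qed

section \<open>Local Lipschitz continuity of the value gap\<close>

text \<open>Meant for \<open>h\<close> the value function, which makes the difference the value gap.
  The first projection does not increase distances, so the two constants simply add on the smaller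
  ball.\<close>

lemma locally_lipschitz_diff_fst:
  fixes f :: "'a::metric_space \<times> 'b::metric_space \<Rightarrow> real"
  assumes f: "locally_lipschitz f" and h: "locally_lipschitz h"
  shows "locally_lipschitz (\<lambda>(x, y). f (x, y) - h x)"
  unfolding locally_lipschitz_def
proof
  fix z :: "'a \<times> 'b"
  obtain d L where d: "d > 0" and L: "L-lipschitz_on (cball z d) f"
    using f unfolding locally_lipschitz_def by blast
  obtain e M where e: "e > 0" and M: "M-lipschitz_on (cball (fst z) e) h"
    using h unfolding locally_lipschitz_def by blast
  have "(L + M)-lipschitz_on (cball z (min d e)) (\<lambda>(x, y). f (x, y) - h x)"
  proof (rule lipschitz_onI)
    show "0 \<le> L + M" using lipschitz_on_nonneg[OF L] lipschitz_on_nonneg[OF M] by simp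
    fix a b assume ab: "a \<in> cball z (min d e)" "b \<in> cball z (min d e)"
    have 1: "dist (f a) (f b) \<le> L * dist a b"
      by (rule lipschitz_onD[OF L]) (use ab in auto)
    have "dist (h (fst a)) (h (fst b)) \<le> M * dist (fst a) (fst b)"
      by (rule lipschitz_onD[OF M])
        (use ab dist_fst_le[of z a] dist_fst_le[of z b] in auto)
    also have "\<dots> \<le> M * dist a b"
      using lipschitz_on_nonneg[OF M] by (intro mult_left_mono dist_fst_le)
    finally show "dist (case a of (x, y) \<Rightarrow> f (x, y) - h x) (case b of (x, y) \<Rightarrow> f (x, y) - h x)
        \<le> (L + M) * dist a b"
      using 1 by (auto simp: case_prod_beta dist_real_def algebra_simps)
  qed
  then show "\<exists>e>0. \<exists>L. L-lipschitz_on (cball z e) (\<lambda>(x, y). f (x, y) - h x)"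
    using d e by (metis min_less_iff_conj)
qed

lemma locally_lipschitz_tendsto:
  assumes "locally_lipschitz \<phi>" and "zs \<longlonglongrightarrow> z"
  shows "(\<lambda>k. \<phi> (zs k)) \<longlonglongrightarrow> \<phi> z"
proof -
  obtain e L where e: "e > 0" and L: "L-lipschitz_on (cball z e) \<phi>"
    using assms(1) unfolding locally_lipschitz_def by blast
  have "continuous_on (ball z e) \<phi>"
    by (rule continuous_on_subset[OF lipschitz_on_continuous_on[OF L]]) auto
  then have "isCont \<phi> z" using e by (auto simp: continuous_on_eq_continuous_at)
  then show ?thesis using assms(2) by (rule isCont_tendsto_compose)
qed

section \<open>Minkowski sums of scaled sets, and complementarity\<close>

text \<open>Replaces a Minkowski sum by one chosen element per index, the form in which limits can
  be taken. An index with \<open>c a = 0\<close> still supplies an element of \<open>S a\<close>,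
  since scaling an empty set leaves it empty.\<close>

lemma in_sum_scaled_sets_iff:
  assumes "finite A"
  shows "x \<in> (\<Sum>a\<in>A. c a *\<^sub>S S a) \<longleftrightarrow> (\<exists>s. (\<forall>a\<in>A. s a \<in> S a) \<and> x = (\<Sum>a\<in>A. c a *\<^sub>R s a))"
proof
  assume "x \<in> (\<Sum>a\<in>A. c a *\<^sub>S S a)"
  then obtain t where t: "\<forall>a\<in>A. t a \<in> c a *\<^sub>S S a" "x = sum t A"
    using assms by (auto simp: set_sum_alt)
  then obtain s where "\<forall>a\<in>A. s a \<in> S a \<and> t a = c a *\<^sub>R s a"
    unfolding image_iff by metis
  with t(2) show "\<exists>s. (\<forall>a\<in>A. s a \<in> S a) \<and> x = (\<Sum>a\<in>A. c a *\<^sub>R s a)" by (auto intro!: exI[of _ s])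
next
  assume "\<exists>s. (\<forall>a\<in>A. s a \<in> S a) \<and> x = (\<Sum>a\<in>A. c a *\<^sub>R s a)"
  then show "x \<in> (\<Sum>a\<in>A. c a *\<^sub>S S a)"
    using assms by (auto simp: set_sum_alt)
qed

lemma sum_scaled_mem:
  assumes "finite A" and "\<And>a. a \<in> A \<Longrightarrow> s a \<in> S a"
  shows "(\<Sum>a\<in>A. c a *\<^sub>R s a) \<in> (\<Sum>a\<in>A. c a *\<^sub>S S a)"
  using assms by (auto simp: in_sum_scaled_sets_iff intro!: exI[of _ s])

text \<open>Complementarity is a single scalar equation, but its terms all have the same sign, so
  each of them vanishes.\<close>

lemma complementarity_zero:
  fixes u c :: "nat \<Rightarrow> real"
  assumes "\<forall>i\<in>A. 0 \<le> u i" "\<forall>i\<in>A. c i \<le> d i" "(\<Sum>i\<in>A. u i * (c i - d i)) = 0" "finite A"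
    and "i \<in> A" "c i \<noteq> d i"
  shows "u i = 0"
proof -
  have "(\<Sum>i\<in>A. u i * (d i - c i)) = - (\<Sum>i\<in>A. u i * (c i - d i))"
    by (simp add: sum_negf[symmetric] algebra_simps)
  then have "(\<Sum>i\<in>A. u i * (d i - c i)) = 0" using assms(3) by simp
  then have "\<forall>i\<in>A. u i * (d i - c i) = 0"
    using assms(1,2,4) by (subst (asm) sum_nonneg_eq_0_iff) auto
  with assms(5,6) show ?thesis by auto
qed

theorem theorem5p7:
  fixes F f :: "(real ^ 'n) \<times> (real ^ 'm) \<Rightarrow> real"
    and G g :: "nat \<Rightarrow> (real ^ 'n) \<times> (real ^ 'm) \<Rightarrow> real"
    and p r :: nat
    and xbar :: "real ^ 'n" and ybar :: "real ^ 'm"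
  assumes "locally_lipschitz F"
    and "\<forall>i\<in>{1..p}. locally_lipschitz (G i)"
    and "locally_lipschitz f"
    and "\<forall>j\<in>{1..r}. locally_lipschitz (g j)"
    and "\<forall>x. \<exists>y. is_arg_min (\<lambda>y. f (x, y)) (lower_feasible r g x) y"
    and "locally_lipschitz (value_function r f g)"
    and "llvfr_feasible p r G f g (xbar, ybar)"
    and "llvfr_subMFC p r F G f g (xbar, ybar)"
  shows "llvfr_KKT p r F G f g (xbar, ybar)"
proof -
  let ?z = "(xbar, ybar)" and ?h = "value_gap r f g"
  have h: "locally_lipschitz ?h"
    unfolding value_gap_def using assms(3,6) by (rule locally_lipschitz_diff_fst)
  obtain I1 I2 I3 where I: "I1 \<subseteq> {i \<in> {1..p}. G i ?z = 0}" "I2 \<subseteq> {j \<in> {1..r}. g j ?z = 0}" "I3 \<subseteq> {1}"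
    and ind: "llvfr_subMFC_independent r G f g ?z I1 I2 I3"
    and seq: "llvfr_subMFC_sequence p r F G f g ?z I1 I2 I3"
    using assms(8) unfolding llvfr_subMFC_def by blast
  from seq obtain zs u v w \<delta> \<delta>' \<gamma> \<epsilon> where
    incl: "\<And>k. \<epsilon> k \<in> clarke_subdiff F (zs k)
                  + (\<Sum>i\<in>{1..p}. u k i *\<^sub>S clarke_subdiff (G i) (zs k))
                  + (\<Sum>j\<in>{1..r}. v k j *\<^sub>S clarke_subdiff (g j) (zs k))
                  + w k *\<^sub>S clarke_subdiff ?h (zs k)"
    and u: "\<And>k. \<forall>i\<in>{1..p}. 0 \<le> u k i" "\<And>k. \<forall>i\<in>{1..p}. G i (zs k) \<le> \<delta> k i"
      "\<And>k. (\<Sum>i\<in>{1..p}. u k i * (G i (zs k) - \<delta> k i)) = 0"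
    and v: "\<And>k. \<forall>j\<in>{1..r}. 0 \<le> v k j" "\<And>k. \<forall>j\<in>{1..r}. g j (zs k) \<le> \<delta>' k j"
      "\<And>k. (\<Sum>j\<in>{1..r}. v k j * (g j (zs k) - \<delta>' k j)) = 0"
    and w: "\<And>k. 0 \<le> w k" "\<And>k. ?h (zs k) \<le> \<gamma> k" "\<And>k. w k * (?h (zs k) - \<gamma> k) = 0"
    and zs: "zs \<longlonglongrightarrow> ?z" and \<gamma>: "\<gamma> \<longlonglongrightarrow> 0" and \<epsilon>: "\<epsilon> \<longlonglongrightarrow> 0"
    and I1: "\<And>k. I1 = {i \<in> {1..p}. G i (zs k) = \<delta> k i}"
    and I2: "\<And>k. I2 = {j \<in> {1..r}. g j (zs k) = \<delta>' k j}"
    and I3: "\<And>k. ?h (zs k) = \<gamma> k \<Longrightarrow> I3 = {1}" "\<And>k. ?h (zs k) < \<gamma> k \<Longrightarrow> I3 = {}"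
    unfolding llvfr_subMFC_sequence_def all_conj_distrib
    by (elim exE conjE) (rule that; (assumption | erule spec | (drule spec, erule mp, assumption)))
  have u0: "u k i = 0" if "i \<in> {1..p} - I1" for k i
    using complementarity_zero[OF u(1-3)[of k]] that I1[of k] by auto
  have v0: "v k j = 0" if "j \<in> {1..r} - I2" for k j
    using complementarity_zero[OF v(1-3)[of k]] that I2[of k] by auto
  have w0: "w k = 0" if "I3 \<noteq> {1}" for k
    using w(3)[of k] I3(1)[of k] that by auto
  \<comment> \<open>\<open>I3 = {1}\<close> excludes strict inequality for every \<open>k\<close>,
    so the gap equals \<open>\<gamma> k\<close> along the whole sequence; continuity of the gap and
    \<open>\<gamma> \<longlonglongrightarrow> 0\<close> give the value at the limit.\<close>
  have gap0: "?h ?z = 0" if "I3 = {1}"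
  proof -
    have "?h (zs k) = \<gamma> k" for k using w(2)[of k] I3(2)[of k] that by fastforce
    then show ?thesis
      using locally_lipschitz_tendsto[OF h zs] \<gamma> by (simp add: LIMSEQ_unique)
  qed
  \<comment> \<open>The inclusion for \<open>\<epsilon> k\<close> is unpacked into concrete
    subgradients, which are then chosen simultaneously for all \<open>k\<close>.\<close>
  have "\<forall>k. \<exists>a s t q. a \<in> clarke_subdiff F (zs k) \<and> (\<forall>i\<in>{1..p}. s i \<in> clarke_subdiff (G i) (zs k))
      \<and> (\<forall>j\<in>{1..r}. t j \<in> clarke_subdiff (g j) (zs k)) \<and> q \<in> clarke_subdiff ?h (zs k)
      \<and> \<epsilon> k = a + (\<Sum>i\<in>{1..p}. u k i *\<^sub>R s i) + (\<Sum>j\<in>{1..r}. v k j *\<^sub>R t j) + w k *\<^sub>R q"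
    (is "\<forall>k. ?P k")
  proof
    fix k
    obtain a S T Q where "a \<in> clarke_subdiff F (zs k)"
      and ST: "S \<in> (\<Sum>i\<in>{1..p}. u k i *\<^sub>S clarke_subdiff (G i) (zs k))"
        "T \<in> (\<Sum>j\<in>{1..r}. v k j *\<^sub>S clarke_subdiff (g j) (zs k))"
      and "Q \<in> w k *\<^sub>S clarke_subdiff ?h (zs k)" "\<epsilon> k = a + S + T + Q"
      using incl[of k] by (elim set_plus_elim) (rule that, assumption+, simp)
    then show "?P k"
      using ST[unfolded in_sum_scaled_sets_iff[OF finite_atLeastAtMost]] by blast
  qed
  then obtain a s t q where dec: "\<And>k. a k \<in> clarke_subdiff F (zs k)"
      "\<And>k. \<forall>i\<in>{1..p}. s k i \<in> clarke_subdiff (G i) (zs k)"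
      "\<And>k. \<forall>j\<in>{1..r}. t k j \<in> clarke_subdiff (g j) (zs k)"
      "\<And>k. q k \<in> clarke_subdiff ?h (zs k)"
      "\<And>k. \<epsilon> k = a k + (\<Sum>i\<in>{1..p}. u k i *\<^sub>R s k i) + (\<Sum>j\<in>{1..r}. v k j *\<^sub>R t k j) + w k *\<^sub>R q k"
    unfolding choice_iff by (elim exE) (rule that; (drule spec, elim conjE, assumption))
  \<comment> \<open>The disjoint sum merges the upper-level constraints, the lower-level constraints
    and the value gap, indexed by \<open>()\<close>, into one family for
    \<open>fritz_john_limit\<close>.\<close>
  let ?A = "{1..p} <+> ({1..r} <+> {()})"
  let ?\<phi> = "case_sum G (case_sum g (\<lambda>_. ?h))"
  let ?s = "\<lambda>k. case_sum (s k) (case_sum (t k) (\<lambda>_. q k))"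
  let ?\<mu> = "\<lambda>k. case_sum (u k) (case_sum (v k) (\<lambda>_. w k))"
  have A: "finite ?A" by simp
  have lip: "\<And>a. a \<in> ?A \<Longrightarrow> locally_lipschitz (?\<phi> a)"
    using assms(2,4) h by auto
  have mem\<phi>: "\<And>k a. a \<in> ?A \<Longrightarrow> ?s k a \<in> clarke_subdiff (?\<phi> a) (zs k)"
    using dec(2-4) by auto
  have nonneg\<mu>: "\<And>k a. a \<in> ?A \<Longrightarrow> 0 \<le> ?\<mu> k a"
    using u(1) v(1) w(1) by auto
  have eqA: "\<And>k. \<epsilon> k = a k + (\<Sum>a\<in>?A. ?\<mu> k a *\<^sub>R ?s k a)"
    by (simp add: dec(5) sum.Plus add.assoc)
  obtain \<rho> \<nu> t0 b where fj: "0 \<le> \<rho>" "\<And>a. a \<in> ?A \<Longrightarrow> 0 \<le> \<nu> a" "\<rho> + (\<Sum>a\<in>?A. \<nu> a) = 1"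
    "t0 \<in> clarke_subdiff F ?z" "\<And>a. a \<in> ?A \<Longrightarrow> b a \<in> clarke_subdiff (?\<phi> a) ?z"
    "\<rho> *\<^sub>R t0 + (\<Sum>a\<in>?A. \<nu> a *\<^sub>R b a) = 0"
    "\<And>a. a \<in> ?A \<Longrightarrow> (\<And>k. ?\<mu> k a = 0) \<Longrightarrow> \<nu> a = 0"
  proof -
    show ?thesis
      by (rule fritz_john_limit[where \<phi> = ?\<phi> and s = ?s and \<mu> = ?\<mu>, OF A assms(1) _ zs \<epsilon> dec(1)])
        (fact lip mem\<phi> nonneg\<mu> eqA that)+
  qed
  define U where "U i = \<nu> (Inl i)" for i
  define V where "V j = \<nu> (Inr (Inl j))" for j
  define W where "W = \<nu> (Inr (Inr ()))"
  define S where "S i = b (Inl i)" for i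
  define T where "T j = b (Inr (Inl j))" for j
  define Q where "Q = b (Inr (Inr ()))"
  have nonneg: "\<forall>i\<in>{1..p}. 0 \<le> U i" "\<forall>j\<in>{1..r}. 0 \<le> V j" "0 \<le> W"
    using fj(2) by (auto simp: U_def V_def W_def)
  have mem: "\<forall>i\<in>{1..p}. S i \<in> clarke_subdiff (G i) ?z" "\<forall>j\<in>{1..r}. T j \<in> clarke_subdiff (g j) ?z"
      "Q \<in> clarke_subdiff ?h ?z"
    using fj(5)[of "Inl _"] fj(5)[of "Inr (Inl _)"] fj(5)[of "Inr (Inr ())"]
    by (auto simp: S_def T_def Q_def)
  have one: "\<rho> + sum U {1..p} + sum V {1..r} + W = 1"
    using fj(3) by (simp add: sum.Plus U_def V_def W_def add.assoc)
  have stat: "\<rho> *\<^sub>R t0 + (\<Sum>i\<in>{1..p}. U i *\<^sub>R S i) + (\<Sum>j\<in>{1..r}. V j *\<^sub>R T j) + W *\<^sub>R Q = 0"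
    using fj(6) by (simp add: sum.Plus U_def V_def W_def S_def T_def Q_def add.assoc)
  have U0: "U i = 0" if "i \<in> {1..p} - I1" for i
    unfolding U_def using that by (intro fj(7)) (auto simp: u0)
  have V0: "V j = 0" if "j \<in> {1..r} - I2" for j
    unfolding V_def using that by (intro fj(7)) (auto simp: v0)
  have W0: "W = 0" if "I3 \<noteq> {1}"
    unfolding W_def using that by (intro fj(7)) (auto simp: w0)
  have sub: "I1 \<subseteq> {1..p}" "I2 \<subseteq> {1..r}" using I by auto
  have fin: "finite I1" "finite I2" using sub finite_subset by blast+
  \<comment> \<open>With \<open>\<rho> = 0\<close> the limit equation involves constraint
    subgradients only, with nonnegative weights supported on \<open>I1\<close>, \<open>I2\<close>,
    \<open>I3\<close>; part (i) of subMFC forbids this.\<close>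
  have "\<rho> \<noteq> 0"
  proof
    assume \<rho>: "\<rho> = 0"
    have restrict: "sum U {1..p} = sum U I1" "sum V {1..r} = sum V I2"
      "(\<Sum>i\<in>{1..p}. U i *\<^sub>R S i) = (\<Sum>i\<in>I1. U i *\<^sub>R S i)"
      "(\<Sum>j\<in>{1..r}. V j *\<^sub>R T j) = (\<Sum>j\<in>I2. V j *\<^sub>R T j)"
      using sub by (auto intro!: sum.mono_neutral_right simp: U0 V0)
    \<comment> \<open>The total weight 1 now falls entirely on the constraints. This also rules out
      the case where all three index sets are empty.\<close>
    have nz: "(\<exists>i\<in>I1. U i \<noteq> 0) \<or> (\<exists>j\<in>I2. V j \<noteq> 0) \<or> (I3 = {1} \<and> W \<noteq> 0)"
    proof (rule ccontr)
      assume "\<not> ?thesis"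
      then have "sum U I1 = 0" "sum V I2 = 0" "W = 0" using W0 by auto
      then show False using one \<rho> restrict by simp
    qed
    have "(\<Sum>i\<in>I1. U i *\<^sub>R S i) \<in> (\<Sum>i\<in>I1. U i *\<^sub>S clarke_subdiff (G i) ?z)"
      "(\<Sum>j\<in>I2. V j *\<^sub>R T j) \<in> (\<Sum>j\<in>I2. V j *\<^sub>S clarke_subdiff (g j) ?z)"
      using mem sub fin by (auto intro!: sum_scaled_mem)
    \<comment> \<open>If \<open>I3 \<noteq> {1}\<close>, then \<open>W = 0\<close>, so the product
      is the zero vector required by the second branch.\<close>
    moreover have "W *\<^sub>R Q \<in> (if I3 = {1} then W *\<^sub>S clarke_subdiff ?h ?z else {0})"
      using mem(3) W0 by auto
    ultimately have "(\<Sum>i\<in>I1. U i *\<^sub>R S i) + (\<Sum>j\<in>I2. V j *\<^sub>R T j) + W *\<^sub>R Q \<in>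
        (\<Sum>i\<in>I1. U i *\<^sub>S clarke_subdiff (G i) ?z)
        + (\<Sum>j\<in>I2. V j *\<^sub>S clarke_subdiff (g j) ?z)
        + (if I3 = {1} then W *\<^sub>S clarke_subdiff ?h ?z else {0})"
      by (intro set_plus_intro)
    then have "0 \<in> (\<Sum>i\<in>I1. U i *\<^sub>S clarke_subdiff (G i) ?z)
        + (\<Sum>j\<in>I2. V j *\<^sub>S clarke_subdiff (g j) ?z)
        + (if I3 = {1} then W *\<^sub>S clarke_subdiff ?h ?z else {0})"
      using stat unfolding \<rho> restrict scaleR_zero_left add_0_left by (simp only:)
    moreover have "\<not> (I1 = {} \<and> I2 = {} \<and> I3 = {})" using nz by auto
    moreover have "\<forall>i\<in>I1. 0 \<le> U i" "\<forall>j\<in>I2. 0 \<le> V j" using nonneg sub by auto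
    ultimately show False
      using ind nz nonneg(3) unfolding llvfr_subMFC_independent_def by blast
  qed
  then have \<rho>: "\<rho> > 0" using fj(1) by simp
  have "(1 / \<rho>) *\<^sub>R (\<rho> *\<^sub>R t0 + (\<Sum>i\<in>{1..p}. U i *\<^sub>R S i) + (\<Sum>j\<in>{1..r}. V j *\<^sub>R T j) + W *\<^sub>R Q) = 0"
    using stat by simp
  then have kkt: "0 = t0 + (\<Sum>i\<in>{1..p}. (U i / \<rho>) *\<^sub>R S i) + (\<Sum>j\<in>{1..r}. (V j / \<rho>) *\<^sub>R T j) + (W / \<rho>) *\<^sub>R Q"
    using \<rho> by (simp add: scaleR_add_right scaleR_sum_right)
  have "(\<Sum>i\<in>{1..p}. (U i / \<rho>) *\<^sub>R S i) \<in> (\<Sum>i\<in>{1..p}. (U i / \<rho>) *\<^sub>S clarke_subdiff (G i) ?z)"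
    "(\<Sum>j\<in>{1..r}. (V j / \<rho>) *\<^sub>R T j) \<in> (\<Sum>j\<in>{1..r}. (V j / \<rho>) *\<^sub>S clarke_subdiff (g j) ?z)"
    using mem by (auto intro: sum_scaled_mem)
  then have "0 \<in> clarke_subdiff F ?z
            + (\<Sum>i\<in>{1..p}. (U i / \<rho>) *\<^sub>S clarke_subdiff (G i) ?z)
            + (\<Sum>j\<in>{1..r}. (V j / \<rho>) *\<^sub>S clarke_subdiff (g j) ?z)
            + (W / \<rho>) *\<^sub>S clarke_subdiff ?h ?z"
    unfolding kkt by (intro set_plus_intro fj(4) imageI mem(3))
  \<comment> \<open>Each term vanishes: on \<open>I1\<close> the constraint is active at the limit,
    and off \<open>I1\<close> the multiplier is zero. The sum over \<open>g\<close> and the value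
    gap term follow the same dichotomy, the latter through \<open>gap0\<close>.\<close>
  moreover have "(\<Sum>i\<in>{1..p}. U i / \<rho> * G i ?z) = 0"
  proof (intro sum.neutral ballI)
    show "U i / \<rho> * G i ?z = 0" if "i \<in> {1..p}" for i
      using U0[of i] I(1) that by (cases "i \<in> I1") auto
  qed
  moreover have "(\<Sum>j\<in>{1..r}. V j / \<rho> * g j ?z) = 0"
  proof (intro sum.neutral ballI)
    show "V j / \<rho> * g j ?z = 0" if "j \<in> {1..r}" for j
      using V0[of j] I(2) that by (cases "j \<in> I2") auto
  qed
  moreover have "W / \<rho> * ?h ?z = 0" using W0 gap0 by auto
  moreover have "(\<forall>i\<in>{1..p}. 0 \<le> U i / \<rho>) \<and> (\<forall>j\<in>{1..r}. 0 \<le> V j / \<rho>) \<and> 0 \<le> W / \<rho>"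
    using nonneg \<rho> by auto
  ultimately show ?thesis
    unfolding llvfr_KKT_def using assms(7)
    by (intro exI[of _ "\<lambda>i. U i / \<rho>"] exI[of _ "\<lambda>j. V j / \<rho>"] exI[of _ "W / \<rho>"]) blast
qed

end
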